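(* Let $p$ be a prime, let $r,n\ge 1$ be integers, and let $M$ be a submodule of the $\mathbb{Z}_{p^r}$-module $\mathbb{Z}_{p^r}^n$. Let $M^\perp=\{v\in\mathbb{Z}_{p^r}^n : \langle u,v\rangle=0 \text{ for all } u\in M\}$, where $\langle u,v\rangle=\sum_{i=1}^n x_iy_i$ for $u=(x_1,\dots,x_n)$ and $v=(y_1,\dots,y_n)$. Then $$|M|\,|M^\perp|=|\mathbb{Z}_{p^r}^n|=p^{rn}.$$
   Context: $\mathbb{Z}_{p^r}$ denotes the ring of integers modulo $p^r$, and $|\cdot|$ denotes the number of elements of a set. *)

theory Defs
  imports "HOL-Number_Theory.Residues" "HOL-Algebra.Module"
begin

text \<open>
  The free module of rank \<open>n\<close> over \<open>R\<close>: vectors are extensional functions on \<open>{1..n}\<close>, so that each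
  coordinate tuple is represented exactly once and cardinalities are the intended ones.  The record
  type of modules extends that of rings; the multiplicative fields are filled with the
  coordinatewise product and are irrelevant for the module structure.
\<close>

definition free_module :: "('a, 'b) ring_scheme \<Rightarrow> nat \<Rightarrow> ('a, nat \<Rightarrow> 'a) module"
  where "free_module R n =
    \<lparr>carrier = {1..n} \<rightarrow>\<^sub>E carrier R,
     monoid.mult = (\<lambda>x y. \<lambda>i\<in>{1..n}. x i \<otimes>\<^bsub>R\<^esub> y i),
     one = (\<lambda>i\<in>{1..n}. \<one>\<^bsub>R\<^esub>),
     zero = (\<lambda>i\<in>{1..n}. \<zero>\<^bsub>R\<^esub>),
     add = (\<lambda>x y. \<lambda>i\<in>{1..n}. x i \<oplus>\<^bsub>R\<^esub> y i),
     smult = (\<lambda>a x. \<lambda>i\<in>{1..n}. a \<otimes>\<^bsub>R\<^esub> x i)\<rparr>"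

definition dot_product :: "('a, 'b) ring_scheme \<Rightarrow> nat \<Rightarrow> (nat \<Rightarrow> 'a) \<Rightarrow> (nat \<Rightarrow> 'a) \<Rightarrow> 'a"
  where "dot_product R n u v = (\<Oplus>\<^bsub>R\<^esub>i\<in>{1..n}. u i \<otimes>\<^bsub>R\<^esub> v i)"

definition orth_complement :: "('a, 'b) ring_scheme \<Rightarrow> nat \<Rightarrow> (nat \<Rightarrow> 'a) set \<Rightarrow> (nat \<Rightarrow> 'a) set"
  where "orth_complement R n M =
    {v \<in> carrier (free_module R n). \<forall>u\<in>M. dot_product R n u v = \<zero>\<^bsub>R\<^esub>}"

lemma (in cring) module_free_module: "module R (free_module R n)"
proof (rule moduleI)
  show "cring R" by (rule is_cring)
  show "abelian_group (free_module R n)"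
  proof (rule abelian_groupI)
    fix x assume x: "x \<in> carrier (free_module R n)"
    have "(\<lambda>i\<in>{1..n}. \<ominus> x i) \<in> carrier (free_module R n)"
      using x by (auto simp: free_module_def PiE_def Pi_def)
    moreover have "(\<lambda>i\<in>{1..n}. \<ominus> x i) \<oplus>\<^bsub>free_module R n\<^esub> x = \<zero>\<^bsub>free_module R n\<^esub>"
      using x by (auto simp: free_module_def PiE_def Pi_def l_neg restrict_def fun_eq_iff)
    ultimately show "\<exists>y\<in>carrier (free_module R n). y \<oplus>\<^bsub>free_module R n\<^esub> x = \<zero>\<^bsub>free_module R n\<^esub>"
      by blast
  qed (auto simp: free_module_def PiE_def Pi_def extensional_def restrict_def fun_eq_iff a_assoc
        intro: a_comm)
qed (auto simp: free_module_def PiE_def Pi_def extensional_def restrict_def fun_eq_iff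
      l_distr r_distr m_assoc)

end

theory Submission
  imports Complex_Main Defs
begin

text \<open>
  With the additive character \<open>\<chi> x = exp (2 \<pi> \<i> x / m)\<close> of the integers modulo \<open>m\<close>, evaluate the
  double sum of \<open>\<chi> \<langle>u, v\<rangle>\<close> over \<open>u \<in> M\<close> and all vectors \<open>v\<close> in two ways. A character that is not
  identically 1 on a group sums to 0 over it. Hence the inner sum over \<open>v\<close> vanishes unless \<open>u = 0\<close>,
  so the double sum is the number of vectors; the inner sum over \<open>u\<close> vanishes unless \<open>v\<close> is
  orthogonal to \<open>M\<close>, so the double sum is also \<open>|M| |M\<^sup>\<bottom>|\<close>.
\<close>

text \<open>Translation by \<open>a\<close> permutes the group, so the sum \<open>S\<close>
  satisfies \<open>S = f a * S\<close>; as \<open>f a \<noteq> 1\<close>, this forces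
  \<open>S = 0\<close>.\<close>

lemma (in group) sum_nontrivial_character_eq_0:
  fixes f :: "'a \<Rightarrow> 'c::field"
  assumes mult: "\<And>x y. x \<in> carrier G \<Longrightarrow> y \<in> carrier G \<Longrightarrow> f (x \<otimes> y) = f x * f y"
    and a: "a \<in> carrier G" "f a \<noteq> 1"
  shows "sum f (carrier G) = 0"
proof -
  have "bij_betw (\<lambda>x. a \<otimes> x) (carrier G) (carrier G)"
    using a inj_on_cmult surj_const_mult by (simp add: bij_betw_def)
  then have "sum f (carrier G) = (\<Sum>x\<in>carrier G. f (a \<otimes> x))"
    by (simp add: sum.reindex_bij_betw)
  also have "\<dots> = f a * sum f (carrier G)"
    using a by (simp add: mult sum_distrib_left)
  finally show ?thesis
    using a by simp
qed

lemma (in cring) dot_product_closed: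
  assumes "u \<in> carrier (free_module R n)" "v \<in> carrier (free_module R n)"
  shows "dot_product R n u v \<in> carrier R"
  using assms by (auto simp: dot_product_def free_module_def PiE_def Pi_def intro!: finsum_closed)

lemma (in cring) dot_product_commute:
  assumes "u \<in> carrier (free_module R n)" "v \<in> carrier (free_module R n)"
  shows "dot_product R n u v = dot_product R n v u"
  unfolding dot_product_def
  by (rule finsum_cong') (use assms in \<open>auto simp: free_module_def PiE_def Pi_def intro: m_comm\<close>)

lemma (in cring) dot_product_add_left:
  assumes "u \<in> carrier (free_module R n)" "v \<in> carrier (free_module R n)"
    and "w \<in> carrier (free_module R n)"
  shows "dot_product R n (u \<oplus>\<^bsub>free_module R n\<^esub> v) w = dot_product R n u w \<oplus> dot_product R n v w"
proof -
  have "dot_product R n (u \<oplus>\<^bsub>free_module R n\<^esub> v) w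
      = (\<Oplus>i\<in>{1..n}. u i \<otimes> w i \<oplus> v i \<otimes> w i)"
    unfolding dot_product_def
    by (rule finsum_cong') (use assms in \<open>auto simp: free_module_def PiE_def Pi_def l_distr\<close>)
  also have "\<dots> = dot_product R n u w \<oplus> dot_product R n v w"
    unfolding dot_product_def
    by (rule finsum_addf) (use assms in \<open>auto simp: free_module_def PiE_def Pi_def\<close>)
  finally show ?thesis .
qed

lemma (in cring) dot_product_zero_left:
  assumes "v \<in> carrier (free_module R n)"
  shows "dot_product R n \<zero>\<^bsub>free_module R n\<^esub> v = \<zero>"
proof -
  have "dot_product R n \<zero>\<^bsub>free_module R n\<^esub> v = (\<Oplus>i\<in>{1..n}. \<zero>)"
    unfolding dot_product_def
    by (rule finsum_cong') (use assms in \<open>auto simp: free_module_def PiE_def Pi_def\<close>)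
  then show ?thesis
    by (simp add: finsum_zero)
qed

text \<open>Pairing \<open>u\<close> with the standard basis vector at a nonzero coordinate of
  \<open>u\<close> returns that coordinate.\<close>

lemma (in cring) dot_product_nondegenerate:
  assumes u: "u \<in> carrier (free_module R n)" and "u \<noteq> \<zero>\<^bsub>free_module R n\<^esub>"
  obtains v where "v \<in> carrier (free_module R n)" "dot_product R n u v \<noteq> \<zero>"
proof -
  \<comment> \<open>Both vectors are extensional, so they can differ only at an index in
    \<open>{1..n}\<close>.\<close>
  obtain i where i: "i \<in> {1..n}" "u i \<noteq> \<zero>"
    using assms by (fastforce simp: free_module_def PiE_def extensional_def fun_eq_iff)
  let ?v = "\<lambda>j\<in>{1..n}. if i = j then \<one> else \<zero>"
  have v: "?v \<in> carrier (free_module R n)"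
    by (auto simp: free_module_def)
  have "dot_product R n u ?v = (\<Oplus>j\<in>{1..n}. if i = j then u j else \<zero>)"
    unfolding dot_product_def
    by (rule finsum_cong') (use u in \<open>auto simp: free_module_def PiE_def Pi_def\<close>)
  also have "\<dots> = u i"
    using u i by (intro add.finprod_singleton) (auto simp: free_module_def PiE_def Pi_def)
  finally show thesis
    using that v i by auto
qed

text \<open>Taken on all integers, so that additivity is immediate; periodicity modulo
  \<open>m\<close> then carries it over to residues, which are represented by integers.\<close>

definition residue_char :: "int \<Rightarrow> int \<Rightarrow> complex"
  where "residue_char m x = cis (2 * pi * of_int x / of_int m)"

lemma residue_char_add: "residue_char m (x + y) = residue_char m x * residue_char m y"
  by (simp add: residue_char_def cis_mult ring_distribs add_divide_distrib)

lemma residue_char_eq_1_iff: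
  assumes "m > 0"
  shows "residue_char m x = 1 \<longleftrightarrow> m dvd x"
proof -
  \<comment> \<open>The real part decides: \<open>cos t = 1\<close> already forces
    \<open>sin t = 0\<close>.\<close>
  have "residue_char m x = 1 \<longleftrightarrow> cos (2 * pi * of_int x / of_int m) = 1"
    by (auto simp: residue_char_def complex_eq_iff cos_one_sin_zero)
  also have "\<dots> \<longleftrightarrow> (\<exists>k::int. of_int x = (of_int (m * k) :: real))"
    using assms by (simp add: cos_one_2pi_int field_simps)
  also have "\<dots> \<longleftrightarrow> m dvd x"
    by (simp only: of_int_eq_iff dvd_def)
  finally show ?thesis .
qed

lemma residue_char_mod:
  assumes "m > 0"
  shows "residue_char m (x mod m) = residue_char m x"
proof -
  \<comment> \<open>Split \<open>x\<close> by division with remainder; the factor at the multiple of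
    \<open>m\<close> is 1.\<close>
  have "residue_char m x = residue_char m (m * (x div m)) * residue_char m (x mod m)"
    by (simp flip: residue_char_add)
  then show ?thesis
    using residue_char_eq_1_iff[OF assms] by simp
qed

lemma (in residues) residue_char_hom:
  "residue_char m (x \<oplus> y) = residue_char m x * residue_char m y"
  using m_gt_one by (simp add: res_add_eq residue_char_mod residue_char_add)

text \<open>The character is faithful because 0 is the only multiple of \<open>m\<close> among the
  representatives \<open>0, ..., m - 1\<close>.\<close>

lemma (in residues) residue_char_eq_1_iff_zero:
  assumes "x \<in> carrier R"
  shows "residue_char m x = 1 \<longleftrightarrow> x = \<zero>"
  using assms m_gt_one
  by (auto simp: residue_char_eq_1_iff res_carrier_eq res_zero_eq zdvd_not_zless dest: zdvd_imp_le)

lemma (in residues) card_free_module: "card (carrier (free_module R n)) = nat m ^ n"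
  using m_gt_one by (simp add: free_module_def card_PiE res_carrier_eq)

text \<open>Character sums see only the additive structure, hence the formulation for additive
  subgroups.\<close>

lemma (in residues) card_mult_card_orth_complement:
  assumes M: "subgroup M (add_monoid (free_module R n))"
  shows "card M * card (orth_complement R n M) = card (carrier (free_module R n))"
proof -
  let ?V = "free_module R n"
  let ?\<chi> = "\<lambda>u v. residue_char m (dot_product R n u v)"
  interpret V: module R ?V
    by (rule module_free_module)
  interpret M: subgroup M "add_monoid ?V"
    by (rule M)
  interpret MG: group "add_monoid ?V\<lparr>carrier := M\<rparr>"
    by (rule M.subgroup_is_group) (rule V.add.is_group)
  have MV: "u \<in> carrier ?V" if "u \<in> M" for u
    using M.subset that by auto
  have finV: "finite (carrier ?V)"
    using m_gt_one by (auto simp: free_module_def res_carrier_eq intro!: finite_PiE)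
  have finM: "finite M"
    using finV MV by (meson finite_subset subsetI)
  have zM: "\<zero>\<^bsub>?V\<^esub> \<in> M"
    using M.one_closed by simp
  have add: "?\<chi> (u \<oplus>\<^bsub>?V\<^esub> v) w = ?\<chi> u w * ?\<chi> v w"
    if "u \<in> carrier ?V" "v \<in> carrier ?V" "w \<in> carrier ?V" for u v w
    using that by (simp add: dot_product_add_left residue_char_hom)
  \<comment> \<open>By faithfulness, a nonzero dot product is exactly what makes a character
    nontrivial.\<close>
  have one: "?\<chi> u v = 1 \<longleftrightarrow> dot_product R n u v = \<zero>"
    if "u \<in> carrier ?V" "v \<in> carrier ?V" for u v
    using that by (simp add: residue_char_eq_1_iff_zero dot_product_closed)
  have sumV: "(\<Sum>v\<in>carrier ?V. ?\<chi> u v) = (if u = \<zero>\<^bsub>?V\<^esub> then of_nat (card (carrier ?V)) else 0)"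
    if u: "u \<in> M" for u
  proof (cases "u = \<zero>\<^bsub>?V\<^esub>")
    case True
    then show ?thesis
      by (simp add: dot_product_zero_left residue_char_eq_1_iff_zero)
  next
    case False
    then obtain a where a: "a \<in> carrier ?V" "dot_product R n u a \<noteq> \<zero>"
      using dot_product_nondegenerate MV u by blast
    \<comment> \<open>The summation variable goes on the left, where \<open>add\<close> gives
      multiplicativity; symmetry of the dot product swaps it back below.\<close>
    have "(\<Sum>v\<in>carrier ?V. ?\<chi> v u) = 0"
      using V.add.sum_nontrivial_character_eq_0[of "\<lambda>v. ?\<chi> v u" a] a MV[OF u] one[of a u]
      by (simp add: add dot_product_commute[of a])
    moreover have "(\<Sum>v\<in>carrier ?V. ?\<chi> v u) = (\<Sum>v\<in>carrier ?V. ?\<chi> u v)"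
      using MV[OF u] by (intro sum.cong) (auto simp: dot_product_commute)
    ultimately show ?thesis
      using False by simp
  qed
  have sumM: "(\<Sum>u\<in>M. ?\<chi> u v) = (if v \<in> orth_complement R n M then of_nat (card M) else 0)"
    if v: "v \<in> carrier ?V" for v
  proof (cases "v \<in> orth_complement R n M")
    case True
    then have "?\<chi> u v = 1" if "u \<in> M" for u
      using that by (simp add: orth_complement_def residue_char_eq_1_iff_zero)
    then show ?thesis
      using True by simp
  next
    case False
    \<comment> \<open>The witness \<open>a\<close> lies in \<open>M\<close> itself, so the character
      sum can be taken over the group \<open>M\<close>.\<close>
    then obtain a where a: "a \<in> M" "dot_product R n a v \<noteq> \<zero>"
      using v by (auto simp: orth_complement_def)
    then show ?thesis
      using MG.sum_nontrivial_character_eq_0[of "\<lambda>u. ?\<chi> u v" a] False v MV one[of a v]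
      by (simp add: add)
  qed
  have "of_nat (card (carrier ?V)) = (\<Sum>u\<in>M. \<Sum>v\<in>carrier ?V. ?\<chi> u v)"
    \<comment> \<open>Only \<open>u = 0\<close> contributes, and it belongs to
      \<open>M\<close>.\<close>
    using zM finM by (simp add: sumV)
  also have "\<dots> = (\<Sum>v\<in>carrier ?V. \<Sum>u\<in>M. ?\<chi> u v)"
    by (rule sum.swap)
  also have "\<dots> = (\<Sum>v\<in>carrier ?V \<inter> orth_complement R n M. of_nat (card M))"
    using finV by (simp add: sumM sum.inter_restrict del: sum_constant)
  also have "carrier ?V \<inter> orth_complement R n M = orth_complement R n M"
    by (auto simp: orth_complement_def)
  \<comment> \<open>The identity is obtained in the complex numbers and descends because
    \<open>of_nat\<close> is injective there.\<close>
  finally have "of_nat (card (carrier ?V)) = (of_nat (card M * card (orth_complement R n M)) :: complex)"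
    by (simp add: mult.commute)
  then show ?thesis
    by (simp only: of_nat_eq_iff)
qed

theorem lemma1:
  fixes p r n :: nat and M :: "(nat \<Rightarrow> int) set"
  defines "R \<equiv> residue_ring (int (p ^ r))"
  assumes "prime p" and "r \<ge> 1" and "n \<ge> 1"
    and "submodule M R (free_module R n)"
  shows "card M * card (orth_complement R n M) = card (carrier (free_module R n)) \<and>
         card (carrier (free_module R n)) = p ^ (r * n)"
proof -
  \<comment> \<open>A residue ring in the locale \<open>residues\<close> must have modulus above 1;
    \<open>r \<ge> 1\<close> ensures this.\<close>
  have "p ^ r > 1"
    using assms prime_gt_1_nat by (intro one_less_power) auto
  then interpret residues "int (p ^ r)" R
    by unfold_locales (use R_def in linarith)+
  show ?thesis
    using card_mult_card_orth_complement[of M n] submodule.axioms(1)[OF assms(5)]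
      card_free_module[of n]
    by (simp add: power_mult nat_power_eq)
qed

end
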